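(* Let $q\in(1,\infty)$, and let $E$ be a separable Banach space with continuous dual $E^*$. Let $(X_i)_{i=1}^\infty$ be i.i.d. $E$-valued random variables with $\mathbb{E}\|X_1\|^q<\infty$. Define $\Lambda:E^*\to\mathbb{R}\cup\{\infty\}$ by $$\Lambda(x^* )=\inf\Big\{m\in\mathbb{R}:\mathbb{E}\big[[(1+\langle x^*,X_1\rangle-m)^+]^q\big]\le1\Big\},$$ and define $\Lambda^*(x)=\sup_{x^*\in E^*}(\langle x^*,x\rangle-\Lambda(x^* ))$ for $x\in E$. Then, for every closed set $A\subset E$, $$\limsup_{n\to\infty}\,n^{q-1}\,\mathbb{P}\Big(\frac1n\sum_{i=1}^nX_i\in A\Big)\le\Big(\inf_{x\in A}\Lambda^*(x)\Big)^{-q}.$$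
   Context: $a^+=\max(a,0)$. Conventions: $\inf\emptyset=\infty$, $0^{-q}=\infty$, $\infty^{-q}=0$. *)

theory Defs
  imports "HOL-Probability.Probability"
begin

text \<open>
  The function $\Lambda$ attached to a random variable \<open>Y\<close> on \<open>M\<close>. The expectation of the
  nonnegative integrand is taken in \<^typ>\<open>ennreal\<close>, and the infimum in \<^typ>\<open>ereal\<close>, so that an
  empty constraint set yields $\infty$.
\<close>

definition Lambda ::
  "'w measure \<Rightarrow> ('w \<Rightarrow> 'a::{banach, second_countable_topology}) \<Rightarrow> real \<Rightarrow> ('a \<Rightarrow>\<^sub>L real) \<Rightarrow> ereal"
where
  "Lambda M Y q f =
     Inf (ereal ` {m :: real.
       (\<integral>\<^sup>+ w. ennreal (max (1 + blinfun_apply f (Y w) - m) 0 powr q) \<partial>M) \<le> 1})"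

definition conj_fun ::
  "(('a::real_normed_vector \<Rightarrow>\<^sub>L real) \<Rightarrow> ereal) \<Rightarrow> 'a \<Rightarrow> ereal"
where
  "conj_fun L x = (SUP f. ereal (blinfun_apply f x) - L f)"

text \<open>
  The power $a^{-q}$ for $a \in [0,\infty]$ with $0^{-q} = \infty$ and $\infty^{-q} = 0$.
  (\<open>powr\<close> on the reals has \<open>0 powr p = 0\<close>, hence the case distinction.)
  Negative arguments are irrelevant: \<open>conj_fun (Lambda M Y q)\<close> is nonnegative because
  \<open>Lambda M Y q 0 = 0\<close> for a probability measure \<open>M\<close> and \<open>q > 0\<close>.
\<close>

definition neg_power :: "ereal \<Rightarrow> real \<Rightarrow> ereal" where
  "neg_power a q =
     (if a = 0 then \<infinity> else if a = \<infinity> then 0 else ereal (real_of_ereal a powr (- q)))"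

end

theory Submission
  imports Defs "HOL-Real_Asymp.Real_Asymp"
begin

text \<open>
  The bound is a dichotomy governed by the mean \<open>\<mu>\<close> of \<open>X 1\<close>.

  The conjugate of \<open>\<Lambda>\<close> vanishes at \<open>\<mu>\<close>: since \<open>u\<^sup>+\<close> to the power \<open>q\<close> lies above its tangent
  \<open>1 + q (u - 1)\<close> at \<open>u = 1\<close>, every \<open>m\<close> admissible for a functional \<open>f\<close> satisfies \<open>f \<mu> \<le> m\<close>, that
  is, \<open>f \<mu> \<le> \<Lambda> f\<close> (\<open>Lambda_ge_mean\<close>). As \<open>\<Lambda> 0 \<le> 0\<close> makes the conjugate nonnegative everywhere, its
  infimum over a set containing \<open>\<mu>\<close> is \<open>0\<close> and the right-hand side is \<open>\<infinity>\<close>.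

  If \<open>\<mu>\<close> is not in the closed set \<open>A\<close>, then \<open>A\<close> stays at some distance \<open>e > 0\<close> from \<open>\<mu>\<close>, and a finite
  \<open>q\<close>-th moment makes the scaled probability tend to \<open>0\<close>: deviations of order \<open>n\<close> of the sum have
  probability \<open>o(n powr (1 - q))\<close> (\<open>iid_rapid_lln\<close>). The right-hand side is nonnegative, so the claim
  follows whatever its value is.

  The law of large numbers with this rate is first proved for the upper tail of nonnegative real
  variables (\<open>iid_upper_tail_rare\<close>). Some summand exceeds \<open>b n\<close> with probability at most
  \<open>n P(W > b n) = o(n powr (1 - q))\<close>; the sum of the variables truncated at \<open>b n\<close> obeys a Chernoff
  bound with parameter \<open>s ln n / n\<close>, which decays like a power of \<open>n\<close> as large as one likes when
  \<open>s\<close> is large and \<open>b\<close> is small. Applied to the indicators of a set and of its complement, the tail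
  bound gives the two-sided law for indicators, hence by linearity for simple functions of the
  variables with values in a Banach space. In a separable space a random vector \<open>Y\<close> is approximated
  by simple functions \<open>s Y\<close> with small mean error, and the tail bound for the nonnegative real
  variables \<open>norm (s Y - Y)\<close> controls the accumulated error.
\<close>

section \<open>Elementary inequalities\<close>

text \<open>For \<open>u \<ge> 0\<close> this is Young's inequality for the product \<open>1 * u\<close>.\<close>

lemma powr_ge_tangent_at_1:
  fixes u q :: real
  assumes "q > 1"
  shows "1 + q * (u - 1) \<le> max u 0 powr q"
proof (cases "u \<ge> 0")
  case True
  have "1 / (q / (q - 1)) + 1 / q = 1" "q / (q - 1) > 1"
    using assms by (auto simp: field_simps)
  from Youngs_inequality[OF this(2) assms this(1), of 1 u] True
  have "u \<le> (q - 1) / q + u powr q / q" by simp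
  hence "q * u \<le> q * ((q - 1) / q + u powr q / q)"
    using assms by (intro mult_left_mono) auto
  also have "\<dots> = q - 1 + u powr q" using assms by (simp add: distrib_left)
  finally show ?thesis using True by (simp add: algebra_simps)
next
  case False
  hence "q * u \<le> 0" using assms by (intro mult_nonneg_nonpos) auto
  thus ?thesis using False assms by (simp add: algebra_simps)
qed

text \<open>
  A second-order estimate that costs only the moment of order \<open>r\<close>: since \<open>exp x (1 - x) \<le> 1\<close>, the
  remainder of the exponential is at most \<open>x\<^sup>2 exp x\<close>, and \<open>x\<^sup>2 \<le> x powr r * exp x\<close> because
  \<open>x powr (2 - r)\<close> is at most \<open>max 1 x \<le> exp x\<close>. This is what lets the Chernoff argument work for
  \<open>q < 2\<close>, where second moments may be infinite.
\<close>

lemma exp_le_powr: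
  fixes x r :: real
  assumes "x \<ge> 0" "1 \<le> r" "r \<le> 2"
  shows "exp x \<le> 1 + x + x powr r * exp (2 * x)"
proof -
  have "exp x * (1 - x^2) \<le> 1 + x"
  proof (cases "x \<le> 1")
    case True
    have "exp x * (1 - x) \<le> exp x * exp (-x)"
      using exp_ge_add_one_self[of "-x"] by (intro mult_left_mono) auto
    hence "exp x * (1 - x) \<le> 1" by (simp add: exp_minus)
    hence "exp x * (1 - x) * (1 + x) \<le> 1 * (1 + x)"
      using assms by (intro mult_right_mono) auto
    thus ?thesis by (simp add: algebra_simps power2_eq_square)
  next
    case False
    hence "exp x * (1 - x^2) \<le> 0"
      by (intro mult_nonneg_nonpos) (auto simp: power2_eq_square intro: mult_mono[of 1 x 1 x, simplified])
    thus ?thesis using assms by linarith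
  qed
  hence "exp x \<le> 1 + x + x^2 * exp x" by (simp add: algebra_simps)
  moreover have "x^2 \<le> x powr r * exp x"
  proof (cases "x = 0")
    case False
    have "x powr (2 - r) \<le> exp x"
    proof (cases "x \<le> 1")
      case True
      hence "x powr (2 - r) \<le> 1" using assms by (intro powr_le1) auto
      thus ?thesis using one_le_exp_iff[of x] assms by linarith
    next
      case False
      hence "x powr (2 - r) \<le> x" using assms powr_mono[of "2 - r" 1 x] by simp
      thus ?thesis using False exp_ge_add_one_self[of x] assms by linarith
    qed
    hence "x powr r * x powr (2 - r) \<le> x powr r * exp x" by (intro mult_left_mono) auto
    thus ?thesis using False assms by (simp flip: powr_add)
  qed auto
  hence "x^2 * exp x \<le> x powr r * exp x * exp x" by (intro mult_right_mono) auto
  ultimately show ?thesis by (simp add: mult.assoc flip: exp_add)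
qed

lemma powr_le_1_plus_powr:
  fixes x r q :: real
  assumes "x \<ge> 0" "0 \<le> r" "r \<le> q"
  shows "x powr r \<le> 1 + x powr q"
proof (cases "x \<le> 1")
  case True
  hence "x powr r \<le> 1" using assms by (intro powr_le1) auto
  thus ?thesis using powr_ge_zero[of x q] by linarith
next
  case False
  hence "x powr r \<le> x powr q" using assms by (intro powr_mono) auto
  thus ?thesis by linarith
qed


section \<open>Independent identically distributed sequences and moments\<close>

context prob_space
begin

definition iid :: "(nat \<Rightarrow> 'a \<Rightarrow> 'b::topological_space) \<Rightarrow> bool" where
  "iid Y \<longleftrightarrow> indep_vars (\<lambda>_. borel) Y {1..} \<and> (\<forall>i\<ge>1. distr M borel (Y i) = distr M borel (Y 1))"

lemma iid_rv: "iid Y \<Longrightarrow> i \<ge> 1 \<Longrightarrow> random_variable borel (Y i)"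
  unfolding iid_def indep_vars_def by blast

lemma iid_distr: "iid Y \<Longrightarrow> i \<ge> 1 \<Longrightarrow> distr M borel (Y i) = distr M borel (Y 1)"
  unfolding iid_def by blast

lemma iid_indep_vars: "iid Y \<Longrightarrow> indep_vars (\<lambda>_. borel) Y {1..}"
  unfolding iid_def by blast

lemma iid_compose:
  assumes Y: "iid Y" and [measurable]: "h \<in> borel_measurable borel"
  shows "iid (\<lambda>i w. h (Y i w))"
proof -
  have "distr M borel (\<lambda>w. h (Y i w)) = distr M borel (\<lambda>w. h (Y 1 w))" if "i \<ge> 1" for i
  proof -
    have push: "distr (distr M borel (Y j)) borel h = distr M borel (\<lambda>w. h (Y j w))" if "j \<ge> 1" for j
      using iid_rv[OF Y that] by (subst distr_distr) (auto simp: comp_def)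
    have "distr M borel (\<lambda>w. h (Y i w)) = distr (distr M borel (Y i)) borel h"
      by (rule push[OF that, symmetric])
    also have "distr M borel (Y i) = distr M borel (Y 1)" by (rule iid_distr[OF Y that])
    also have "distr (distr M borel (Y 1)) borel h = distr M borel (\<lambda>w. h (Y 1 w))"
      by (rule push[of 1]) simp
    finally show ?thesis .
  qed
  moreover have "indep_vars (\<lambda>_. borel) (\<lambda>i w. h (Y i w)) {1..}"
    using iid_indep_vars[OF Y] by (rule indep_vars_compose2) simp
  ultimately show ?thesis unfolding iid_def by blast
qed

lemma iid_expectation:
  fixes h :: "'b::topological_space \<Rightarrow> 'c::{banach, second_countable_topology}"
  assumes Y: "iid Y" and h: "h \<in> borel_measurable borel" and i: "i \<ge> 1"
  shows "expectation (\<lambda>w. h (Y i w)) = expectation (\<lambda>w. h (Y 1 w))"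
proof -
  have "expectation (\<lambda>w. h (Y i w)) = integral\<^sup>L (distr M borel (Y i)) h"
    using iid_rv[OF Y i] h by (intro integral_distr[symmetric]) auto
  also have "distr M borel (Y i) = distr M borel (Y 1)" by (rule iid_distr[OF Y i])
  also have "integral\<^sup>L (distr M borel (Y 1)) h = expectation (\<lambda>w. h (Y 1 w))"
    using iid_rv[OF Y, of 1] h by (intro integral_distr) auto
  finally show ?thesis .
qed

lemma iid_prob:
  assumes Y: "iid Y" and B: "B \<in> sets borel" and i: "i \<ge> 1"
  shows "prob {w \<in> space M. Y i w \<in> B} = prob {w \<in> space M. Y 1 w \<in> B}"
proof -
  have "prob {w \<in> space M. Y i w \<in> B} = measure (distr M borel (Y i)) B"
    using iid_rv[OF Y i] B by (subst measure_distr) (auto simp: vimage_def Int_def conj_commute)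
  also have "distr M borel (Y i) = distr M borel (Y 1)" by (rule iid_distr[OF Y i])
  also have "measure (distr M borel (Y 1)) B = prob {w \<in> space M. Y 1 w \<in> B}"
    using iid_rv[OF Y, of 1] B by (subst measure_distr) (auto simp: vimage_def Int_def conj_commute)
  finally show ?thesis .
qed

lemma integrable_norm_powr_le:
  fixes V :: "'a \<Rightarrow> 'b::{real_normed_vector, second_countable_topology}"
  assumes [measurable]: "random_variable borel V" and int: "integrable M (\<lambda>w. norm (V w) powr q)"
    and p: "0 \<le> p" "p \<le> q"
  shows "integrable M (\<lambda>w. norm (V w) powr p)"
proof (rule Bochner_Integration.integrable_bound)
  show "integrable M (\<lambda>w. 1 + norm (V w) powr q)" using int by simp
  show "AE w in M. norm (norm (V w) powr p) \<le> norm (1 + norm (V w) powr q)"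
    using powr_le_1_plus_powr[OF norm_ge_zero p] by (auto simp: abs_of_nonneg)
qed measurable

lemma integrable_if_norm_powr:
  fixes V :: "'a \<Rightarrow> 'b::{banach, second_countable_topology}"
  assumes V: "random_variable borel V" and int: "integrable M (\<lambda>w. norm (V w) powr q)" and q: "q \<ge> 1"
  shows "integrable M V"
  using integrable_norm_powr_le[OF V int, of 1] q V by (simp add: integrable_norm_iff)


section \<open>Rare sequences of events\<close>

text \<open>
  The probabilities are \<open>o(n powr (1 - q))\<close>. Measurability is part of the notion because \<open>prob\<close> is \<open>0\<close>
  on nonmeasurable sets, which would break the union bound.
\<close>

definition rare :: "real \<Rightarrow> (nat \<Rightarrow> 'a set) \<Rightarrow> bool" where
  "rare q E \<longleftrightarrow> (\<forall>n. E n \<in> events) \<and> (\<lambda>n. real n powr (q - 1) * prob (E n)) \<longlonglongrightarrow> 0"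

lemma rare_if_subset_Un:
  assumes E: "rare q E" "rare q F" and sub: "\<And>n. G n \<subseteq> E n \<union> F n" and G: "\<And>n. G n \<in> events"
  shows "rare q G"
proof -
  have "(\<lambda>n. real n powr (q - 1) * prob (G n)) \<longlonglongrightarrow> 0"
  proof (rule tendsto_sandwich[of "\<lambda>_. 0", OF _ _ tendsto_const])
    show "(\<lambda>n. real n powr (q - 1) * prob (E n) + real n powr (q - 1) * prob (F n)) \<longlonglongrightarrow> 0"
      using E tendsto_add[of _ 0 _ _ 0] unfolding rare_def by fastforce
    have "prob (G n) \<le> prob (E n) + prob (F n)" for n
    proof -
      have "prob (G n) \<le> prob (E n \<union> F n)"
        using E sub unfolding rare_def by (intro finite_measure_mono) auto
      also have "\<dots> \<le> prob (E n) + prob (F n)"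
        using E unfolding rare_def by (intro measure_subadditive) auto
      finally show ?thesis .
    qed
    hence "real n powr (q - 1) * prob (G n)
        \<le> real n powr (q - 1) * (prob (E n) + prob (F n))" for n
      by (intro mult_left_mono) auto
    thus "\<forall>\<^sub>F n in sequentially. real n powr (q - 1) * prob (G n)
        \<le> real n powr (q - 1) * prob (E n) + real n powr (q - 1) * prob (F n)"
      by (simp add: distrib_left)
  qed auto
  thus ?thesis using G unfolding rare_def by auto
qed

text \<open>
  A strengthening of Markov's inequality, which would only bound the sequence: the functions
  \<open>n powr q * indicator {V > b n}\<close> are dominated by \<open>V powr q / b powr q\<close> and each point is
  eventually outside of the event.
\<close>

lemma powr_times_tail_tendsto_0:
  fixes V :: "'a \<Rightarrow> real"
  assumes [measurable]: "random_variable borel V" and V: "\<And>w. V w \<ge> 0"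
    and int: "integrable M (\<lambda>w. V w powr q)" and q: "q \<ge> 0" and b: "b > 0"
  shows "(\<lambda>n. real n powr q * prob {w \<in> space M. V w > b * real n}) \<longlonglongrightarrow> 0"
proof -
  let ?f = "\<lambda>n w. real n powr q * indicator {w \<in> space M. V w > b * real n} w :: real"
  have "(\<lambda>n. expectation (?f n)) \<longlonglongrightarrow> expectation (\<lambda>_. 0)"
  proof (rule integral_dominated_convergence)
    show "integrable M (\<lambda>w. V w powr q / b powr q)" using int by auto
    show "AE w in M. (\<lambda>n. ?f n w) \<longlonglongrightarrow> 0"
    proof (rule AE_I2)
      fix w
      have "eventually (\<lambda>n. real n > V w / b) sequentially"
        by real_asymp
      hence "eventually (\<lambda>n. ?f n w = 0) sequentially"
        by eventually_elim (use b in \<open>auto simp: indicator_def field_simps\<close>)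
      thus "(\<lambda>n. ?f n w) \<longlonglongrightarrow> 0" by (rule tendsto_eventually)
    qed
    show "AE w in M. norm (?f n w) \<le> V w powr q / b powr q" for n
    proof (rule AE_I2)
      fix w
      show "norm (?f n w) \<le> V w powr q / b powr q"
      proof (cases "V w > b * real n")
        case True
        have "real n powr q * b powr q = (b * real n) powr q"
          using b by (simp add: powr_mult mult.commute)
        also have "\<dots> \<le> V w powr q" using True b q by (intro powr_mono2) auto
        finally show ?thesis using b V[of w] by (auto simp: indicator_def field_simps)
      qed (auto simp: indicator_def)
    qed
  qed auto
  moreover have "expectation (?f n) = real n powr q * prob {w \<in> space M. V w > b * real n}" for n
    by (subst integral_mult_right_zero, subst Bochner_Integration.integral_indicator) (simp_all add: Int_def conj_commute)
  ultimately show ?thesis by simp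
qed

section \<open>The upper tail of nonnegative real sums\<close>

text \<open>
  The Chernoff bound with parameter \<open>l\<close>. For \<open>x = l * min (W 1 w) c\<close> the factor \<open>exp (2 * x)\<close> in
  \<open>exp_le_powr\<close> is at most \<open>exp (2 * l * c)\<close>, so the truncation keeps the moment
  generating function finite although \<open>W 1\<close> has only power moments.
\<close>

lemma truncated_sum_chernoff:
  fixes W :: "nat \<Rightarrow> 'a \<Rightarrow> real"
  assumes W: "iid W" and nonneg: "\<And>i w. W i w \<ge> 0"
    and int: "integrable M (W 1)" "integrable M (\<lambda>w. W 1 w powr r)"
    and r: "1 \<le> r" "r \<le> 2" and l: "l \<ge> 0" and c: "c \<ge> 0"
  shows "prob {w \<in> space M. (\<Sum>i=1..n. min (W i w) c) \<ge> t}
    \<le> exp (real n * (l * expectation (W 1) + l powr r * expectation (\<lambda>w. W 1 w powr r) * exp (2 * l * c)) - l * t)"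
proof -
  define g where "g x = exp (l * min x c)" for x
  have [measurable]: "g \<in> borel_measurable borel" unfolding g_def by measurable
  have rv: "\<And>i. i \<ge> 1 \<Longrightarrow> random_variable borel (W i)" by (rule iid_rv[OF W])
  have [measurable]: "random_variable borel (W 1)" by (rule rv) auto
  define m where "m = l * expectation (W 1) + l powr r * expectation (\<lambda>w. W 1 w powr r) * exp (2 * l * c)"
  have g_int: "integrable M (\<lambda>w. g (W i w))" if "i \<ge> 1" for i
  proof (rule integrable_const_bound)
    show "AE w in M. norm (g (W i w)) \<le> exp (l * c)"
      using l by (auto simp: g_def intro!: mult_left_mono)
    show "random_variable borel (\<lambda>w. g (W i w))" using rv[OF that] by measurable
  qed
  have g_exp: "expectation (\<lambda>w. g (W 1 w)) \<le> exp m"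
  proof -
    have "expectation (\<lambda>w. g (W 1 w))
      \<le> expectation (\<lambda>w. 1 + l * W 1 w + l powr r * W 1 w powr r * exp (2 * l * c))"
    proof (rule integral_mono)
      fix w
      let ?x = "l * min (W 1 w) c"
      have x: "?x \<ge> 0" "?x \<le> l * W 1 w" "?x \<le> l * c"
        using l c nonneg[of 1 w] by (auto intro: mult_left_mono)
      have "g (W 1 w) \<le> 1 + ?x + ?x powr r * exp (2 * ?x)"
        unfolding g_def by (rule exp_le_powr) (use x r in auto)
      also have "\<dots> \<le> 1 + l * W 1 w + (l * W 1 w) powr r * exp (2 * (l * c))"
        using x r l c nonneg[of 1 w] by (intro add_mono mult_mono powr_mono2) auto
      finally show "g (W 1 w) \<le> 1 + l * W 1 w + l powr r * W 1 w powr r * exp (2 * l * c)"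
        using l nonneg[of 1 w] by (simp add: powr_mult mult.assoc)
    qed (use int g_int[of 1] in auto)
    also have "\<dots> = 1 + m" unfolding m_def using int by (simp add: prob_space)
    also have "\<dots> \<le> exp m" by (rule exp_ge_add_one_self)
    finally show ?thesis .
  qed
  have ind: "indep_vars (\<lambda>_. borel) (\<lambda>i w. g (W i w)) {1..n}"
    by (rule indep_vars_subset[OF iid_indep_vars[OF iid_compose[OF W]]]) auto
  have prod: "expectation (\<lambda>w. \<Prod>i=1..n. g (W i w)) = (\<Prod>i=1..n. expectation (\<lambda>w. g (W i w)))"
    by (rule indep_vars_lebesgue_integral) (use ind g_int in auto)
  have prod_int: "integrable M (\<lambda>w. \<Prod>i=1..n. g (W i w))"
    by (rule indep_vars_integrable) (use ind g_int in auto)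
  have "(\<Prod>i=1..n. expectation (\<lambda>w. g (W i w))) = (\<Prod>i=1..n. expectation (\<lambda>w. g (W 1 w)))"
    by (intro prod.cong refl iid_expectation[OF W]) auto
  also have "\<dots> = expectation (\<lambda>w. g (W 1 w)) ^ n" by simp
  also have "\<dots> \<le> exp m ^ n" by (intro power_mono g_exp) (simp add: g_def)
  also have "\<dots> = exp (real n * m)" by (simp add: exp_of_nat_mult)
  finally have E: "expectation (\<lambda>w. \<Prod>i=1..n. g (W i w)) \<le> exp (real n * m)" using prod by simp
  have rv': "\<And>i. i \<in> {1..n} \<Longrightarrow> random_variable borel (W i)" using rv by auto
  have [measurable]: "random_variable borel (\<lambda>w. \<Sum>i=1..n. min (W i w) c)"
    using rv' by (intro borel_measurable_sum borel_measurable_min) auto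
  have G: "(\<Prod>i=1..n. g (W i w)) = exp (l * (\<Sum>i=1..n. min (W i w) c))" for w
    unfolding g_def by (simp add: exp_sum sum_distrib_left)
  have "prob {w \<in> space M. (\<Sum>i=1..n. min (W i w) c) \<ge> t}
      \<le> prob {w \<in> space M. (\<Prod>i=1..n. g (W i w)) \<ge> exp (l * t)}"
  proof (rule finite_measure_mono)
    show "{w \<in> space M. (\<Prod>i=1..n. g (W i w)) \<ge> exp (l * t)} \<in> events"
      unfolding G by measurable
    show "{w \<in> space M. t \<le> (\<Sum>i=1..n. min (W i w) c)}
        \<subseteq> {w \<in> space M. exp (l * t) \<le> (\<Prod>i=1..n. g (W i w))}"
      unfolding G using l by (auto intro: mult_left_mono)
  qed
  also have "\<dots> \<le> expectation (\<lambda>w. \<Prod>i=1..n. g (W i w)) / exp (l * t)"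
    by (rule integral_Markov_inequality_measure[OF prod_int, where A="{}"]) (auto simp: g_def intro!: prod_nonneg)
  also have "\<dots> \<le> exp (real n * m) / exp (l * t)" by (intro divide_right_mono E) auto
  also have "\<dots> = exp (real n * m - l * t)" by (simp add: exp_diff)
  finally show ?thesis unfolding m_def .
qed

text \<open>
  With \<open>l = s ln n / n\<close> and truncation at \<open>b n\<close>, the exponent in \<open>truncated_sum_chernoff\<close> is
  \<open>- s e ln n\<close> up to an error \<open>K (s ln n) powr r * n powr (1 - r + 2 s b)\<close>. Choosing \<open>s = q / e\<close> gives
  the factor \<open>n powr (- q)\<close>, and then \<open>b\<close> is taken so small that \<open>1 - r + 2 s b < 0\<close> and the error
  vanishes; this needs \<open>r > 1\<close>, hence \<open>q > 1\<close>.
\<close>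

lemma iid_upper_tail_rare:
  fixes W :: "nat \<Rightarrow> 'a \<Rightarrow> real"
  assumes W: "iid W" and nonneg: "\<And>i w. W i w \<ge> 0"
    and int: "integrable M (\<lambda>w. W 1 w powr q)" and q: "q > 1" and e: "e > 0"
  shows "rare q (\<lambda>n. {w \<in> space M. (\<Sum>i=1..n. W i w) \<ge> real n * (expectation (W 1) + e)})"
proof -
  have rv: "\<And>i. i \<ge> 1 \<Longrightarrow> random_variable borel (W i)" by (rule iid_rv[OF W])
  have [measurable]: "random_variable borel (W (Suc 0))" by (rule rv) auto
  define r where "r = min q 2"
  have r: "1 < r" "r \<le> 2" "r \<le> q" using q unfolding r_def by auto
  have norm_W: "norm (W 1 w) = W 1 w" for w using nonneg by simp
  have W1: "random_variable borel (W 1)" by (rule rv) simp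
  have int1: "integrable M (W 1)"
    by (rule integrable_if_norm_powr[OF W1, of q]) (use int q in \<open>simp_all only: norm_W\<close>)
  have intr: "integrable M (\<lambda>w. W 1 w powr r)"
    using integrable_norm_powr_le[OF W1, of q r] int r by (simp only: norm_W)
  define \<mu> where "\<mu> = expectation (W 1)"
  define K where "K = expectation (\<lambda>w. W 1 w powr r)"
  define s where "s = q / e"
  define b where "b = (r - 1) / (4 * s)"
  have s: "s > 0" and b: "b > 0" using q e r unfolding s_def b_def by auto
  \<comment> \<open>Either the truncated sum is large, or some summand is affected by the truncation.\<close>
  define T where "T n = {w \<in> space M. (\<Sum>i=1..n. min (W i w) (b * real n)) \<ge> real n * (\<mu> + e)}" for n
  define J where "J n = (\<Union>i\<in>{1..n}. {w \<in> space M. W i w \<in> {b * real n<..}})" for n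
  have jump: "{w \<in> space M. W i w \<in> {b * real n<..}} \<in> events" if "i \<in> {1..n}" for i n
  proof -
    have [measurable]: "random_variable borel (W i)" by (rule rv) (use that in auto)
    show ?thesis by measurable
  qed
  have J: "rare q J"
    unfolding rare_def
  proof safe
    show ev: "J n \<in> events" for n unfolding J_def
      by (rule sets.finite_UN[OF _ jump]) auto
    have "prob (J n) \<le> real n * prob {w \<in> space M. W 1 w > b * real n}" for n
    proof -
      have "prob (J n) \<le> (\<Sum>i\<in>{1..n}. prob {w \<in> space M. W i w \<in> {b * real n<..}})"
        unfolding J_def
        by (rule measure_UNION_le[OF _ jump]) auto
      also have "\<dots> = (\<Sum>i\<in>{1..n}. prob {w \<in> space M. W 1 w \<in> {b * real n<..}})"
        by (intro sum.cong iid_prob[OF W]) auto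
      finally show ?thesis by simp
    qed
    hence *: "real n powr (q - 1) * prob (J n) \<le> real n powr (q - 1) * (real n * prob {w \<in> space M. W 1 w > b * real n})" for n
      by (intro mult_left_mono) auto
    have "real n powr (q - 1) * real n = real n powr q" for n
      using q by (cases "n = 0") (auto simp: powr_diff)
    hence **: "real n powr (q - 1) * prob (J n) \<le> real n powr q * prob {w \<in> space M. W 1 w > b * real n}" for n
      using *[of n] by (simp flip: mult.assoc)
    show "(\<lambda>n. real n powr (q - 1) * prob (J n)) \<longlonglongrightarrow> 0"
      by (rule tendsto_sandwich[OF _ _ tendsto_const powr_times_tail_tendsto_0[of "W 1" q b]])
         (use ** int nonneg q b in auto)
  qed
  have T: "rare q T"
    unfolding rare_def
  proof safe
    show "T n \<in> events" for n unfolding T_def using rv by measurable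
    show "(\<lambda>n. real n powr (q - 1) * prob (T n)) \<longlonglongrightarrow> 0"
    proof (rule tendsto_sandwich[of "\<lambda>_. 0", OF _ _ tendsto_const])
      define h where "h n = n powr (-1) * exp (K * s powr r * (ln n powr r * n powr (- (r - 1) / 2)))" for n :: real
      show "(\<lambda>n. h (real n)) \<longlonglongrightarrow> 0"
      proof -
        have "((\<lambda>n. ln n powr r * n powr (- (r - 1) / 2)) \<longlongrightarrow> 0) at_top"
          using r by real_asymp
        hence "((\<lambda>n. K * s powr r * (ln n powr r * n powr (- (r - 1) / 2))) \<longlongrightarrow> K * s powr r * 0) at_top"
          by (rule tendsto_mult_left)
        hence "((\<lambda>n. exp (K * s powr r * (ln n powr r * n powr (- (r - 1) / 2)))) \<longlongrightarrow> exp (K * s powr r * 0)) at_top"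
          by (rule tendsto_exp)
        moreover have "((\<lambda>n::real. n powr (-1)) \<longlongrightarrow> 0) at_top" by real_asymp
        ultimately have "(h \<longlongrightarrow> 0 * exp (K * s powr r * 0)) at_top"
          unfolding h_def by (intro tendsto_mult)
        thus ?thesis by (simp add: filterlim_compose[OF _ filterlim_real_sequentially])
      qed
      show "\<forall>\<^sub>F n in sequentially. real n powr (q - 1) * prob (T n) \<le> h (real n)"
        using eventually_gt_at_top[of 1]
      proof eventually_elim
        case (elim n)
        define N where "N = real n"
        define L where "L = ln N"
        have N: "N > 1" and L: "L > 0" using elim unfolding N_def L_def by auto
        define l where "l = s * L / N"
        have l: "l \<ge> 0" using s L N unfolding l_def by auto
        have bound: "prob (T n) \<le> exp (N * (l * \<mu> + l powr r * K * exp (2 * l * (b * N))) - l * (N * (\<mu> + e)))"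
          unfolding T_def N_def \<mu>_def K_def
          by (rule truncated_sum_chernoff[OF W nonneg int1 intr]) (use r l b in auto)
        have "N * (l * \<mu>) - l * (N * (\<mu> + e)) = - (N * l * e)" by (simp add: algebra_simps)
        also have "N * l * e = q * L" unfolding l_def s_def using N e by simp
        finally have 1: "N * (l * \<mu>) - l * (N * (\<mu> + e)) = - (q * L)" .
        have "2 * l * (b * N) = (r - 1) / 2 * L" unfolding l_def b_def using N s by (simp add: field_simps)
        hence 2: "exp (2 * l * (b * N)) = N powr ((r - 1) / 2)" using N unfolding L_def powr_def by simp
        have 3: "l powr r = s powr r * L powr r * N powr (-r)"
          unfolding l_def using s L N by (simp add: powr_mult powr_divide powr_minus_divide)
        have 4: "N * N powr (-r) * N powr ((r - 1) / 2) = N powr (- (r - 1) / 2)"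
        proof -
          have "N * N powr (-r) * N powr ((r - 1) / 2) = N powr (1 + (-r) + (r - 1) / 2)"
            using N unfolding powr_add by simp
          also have "1 + (-r) + (r - 1) / 2 = - (r - 1) / 2" by (simp add: field_simps)
          finally show ?thesis .
        qed
        have "N * (l powr r * K * exp (2 * l * (b * N))) = K * s powr r * L powr r * (N * N powr (-r) * N powr ((r - 1) / 2))"
          unfolding 2 3 by simp
        also have "\<dots> = K * s powr r * (L powr r * N powr (- (r - 1) / 2))" unfolding 4 by simp
        finally have 5: "N * (l powr r * K * exp (2 * l * (b * N))) = K * s powr r * (L powr r * N powr (- (r - 1) / 2))" .
        have "N * (l * \<mu> + l powr r * K * exp (2 * l * (b * N))) - l * (N * (\<mu> + e))
           = - (q * L) + K * s powr r * (L powr r * N powr (- (r - 1) / 2))"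
          using 1 unfolding distrib_left[of N] 5 by linarith
        hence "prob (T n) \<le> exp (- (q * L) + K * s powr r * (L powr r * N powr (- (r - 1) / 2)))"
          using bound by (simp only:)
        also have "\<dots> = exp (- (q * L)) * exp (K * s powr r * (L powr r * N powr (- (r - 1) / 2)))"
          by (rule exp_add)
        also have "exp (- (q * L)) = N powr (-q)" using N by (simp add: powr_def L_def)
        finally have "prob (T n) \<le> N powr (-q) * exp (K * s powr r * (L powr r * N powr (- (r - 1) / 2)))" .
        hence "N powr (q - 1) * prob (T n) \<le> N powr (q - 1) * (N powr (-q) * exp (K * s powr r * (L powr r * N powr (- (r - 1) / 2))))"
          by (intro mult_left_mono) auto
        also have "\<dots> = h N" unfolding h_def L_def mult.assoc[symmetric] powr_add[symmetric] by simp
        finally show ?case unfolding N_def .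
      qed
    qed auto
  qed
  show ?thesis
  proof (rule rare_if_subset_Un[OF T J])
    fix n
    show "{w \<in> space M. real n * (expectation (W 1) + e) \<le> (\<Sum>i = 1..n. W i w)} \<subseteq> T n \<union> J n"
    proof
      fix w assume w: "w \<in> {w \<in> space M. real n * (expectation (W 1) + e) \<le> (\<Sum>i = 1..n. W i w)}"
      show "w \<in> T n \<union> J n"
      proof (cases "w \<in> J n")
        case False
        hence "\<And>i. i \<in> {1..n} \<Longrightarrow> W i w \<le> b * real n" using w unfolding J_def by force
        hence "(\<Sum>i = 1..n. min (W i w) (b * real n)) = (\<Sum>i = 1..n. W i w)"
          by (intro sum.cong) auto
        thus ?thesis using w unfolding T_def \<mu>_def by auto
      qed auto
    qed
    show "{w \<in> space M. real n * (expectation (W 1) + e) \<le> (\<Sum>i = 1..n. W i w)} \<in> events"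
      using rv by measurable
  qed
qed


section \<open>The law of large numbers with a rate\<close>

definition rapid_lln :: "real \<Rightarrow> (nat \<Rightarrow> 'a \<Rightarrow> 'b::{real_normed_vector, second_countable_topology}) \<Rightarrow> 'b \<Rightarrow> bool" where
  "rapid_lln q Y v \<longleftrightarrow> (\<forall>i\<ge>1. random_variable borel (Y i)) \<and>
     (\<forall>e>0. rare q (\<lambda>n. {w \<in> space M. norm ((\<Sum>i=1..n. Y i w) - real n *\<^sub>R v) \<ge> real n * e}))"

lemma rapid_lln_rv: "rapid_lln q Y v \<Longrightarrow> i \<ge> 1 \<Longrightarrow> random_variable borel (Y i)"
  unfolding rapid_lln_def by blast

lemma rapid_llnD:
  "rapid_lln q Y v \<Longrightarrow> e > 0 \<Longrightarrow>
     rare q (\<lambda>n. {w \<in> space M. norm ((\<Sum>i=1..n. Y i w) - real n *\<^sub>R v) \<ge> real n * e})"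
  unfolding rapid_lln_def by blast

lemma deviation_event:
  fixes Y :: "nat \<Rightarrow> 'a \<Rightarrow> 'b::{real_normed_vector, second_countable_topology}"
  assumes "\<And>i. i \<ge> 1 \<Longrightarrow> random_variable borel (Y i)"
  shows "{w \<in> space M. norm ((\<Sum>i=1..n. Y i w) - v) \<ge> c} \<in> events"
proof -
  have [measurable]: "random_variable borel (\<lambda>w. \<Sum>i=1..n. Y i w)"
    using assms by (intro borel_measurable_sum) auto
  show ?thesis by measurable
qed

text \<open>
  Reduces the law to a cover of the deviation event by two rare events, whose choice may depend on \<open>e\<close>.
\<close>

lemma rapid_llnI:
  assumes rv: "\<And>i. i \<ge> 1 \<Longrightarrow> random_variable borel (Y i)"
    and "\<And>e. e > 0 \<Longrightarrow> \<exists>E F. rare q E \<and> rare q F \<and>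
      (\<forall>n. {w \<in> space M. norm ((\<Sum>i=1..n. Y i w) - real n *\<^sub>R v) \<ge> real n * e} \<subseteq> E n \<union> F n)"
  shows "rapid_lln q Y v"
  unfolding rapid_lln_def
proof (intro conjI allI impI)
  fix e :: real assume "e > 0"
  from assms(2)[OF this] obtain E F where "rare q E" "rare q F"
    and sub: "\<forall>n. {w \<in> space M. norm ((\<Sum>i=1..n. Y i w) - real n *\<^sub>R v) \<ge> real n * e} \<subseteq> E n \<union> F n"
    by blast
  show "rare q (\<lambda>n. {w \<in> space M. norm ((\<Sum>i=1..n. Y i w) - real n *\<^sub>R v) \<ge> real n * e})"
    using \<open>rare q E\<close> \<open>rare q F\<close> by (rule rare_if_subset_Un[OF _ _ spec[OF sub] deviation_event[OF rv]])
qed (rule rv)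

lemma rapid_lln_add:
  assumes Y: "rapid_lln q Y v" and Z: "rapid_lln q Z u"
  shows "rapid_lln q (\<lambda>i w. Y i w + Z i w) (v + u)"
proof (rule rapid_llnI)
  show "random_variable borel (\<lambda>w. Y i w + Z i w)" if "i \<ge> 1" for i
    using rapid_lln_rv[OF Y that] rapid_lln_rv[OF Z that] by measurable
  fix e :: real assume "e > 0"
  hence e: "e / 2 > 0" by simp
  let ?E = "\<lambda>n. {w \<in> space M. norm ((\<Sum>i=1..n. Y i w) - real n *\<^sub>R v) \<ge> real n * (e / 2)}"
  let ?F = "\<lambda>n. {w \<in> space M. norm ((\<Sum>i=1..n. Z i w) - real n *\<^sub>R u) \<ge> real n * (e / 2)}"
  have sub: "{w \<in> space M. norm ((\<Sum>i=1..n. Y i w + Z i w) - real n *\<^sub>R (v + u)) \<ge> real n * e} \<subseteq> ?E n \<union> ?F n" for n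
  proof safe
    fix w assume w: "w \<in> space M" "real n * e \<le> norm ((\<Sum>i=1..n. Y i w + Z i w) - real n *\<^sub>R (v + u))"
      and "\<not> real n * (e / 2) \<le> norm ((\<Sum>i=1..n. Z i w) - real n *\<^sub>R u)"
    have "(\<Sum>i=1..n. Y i w + Z i w) - real n *\<^sub>R (v + u)
        = ((\<Sum>i=1..n. Y i w) - real n *\<^sub>R v) + ((\<Sum>i=1..n. Z i w) - real n *\<^sub>R u)"
      by (simp add: sum.distrib scaleR_add_right)
    with norm_triangle_ineq[of "(\<Sum>i=1..n. Y i w) - real n *\<^sub>R v" "(\<Sum>i=1..n. Z i w) - real n *\<^sub>R u"] w
    have "real n * e \<le> norm ((\<Sum>i=1..n. Y i w) - real n *\<^sub>R v) + norm ((\<Sum>i=1..n. Z i w) - real n *\<^sub>R u)"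
      by simp
    with \<open>\<not> _\<close> show "real n * (e / 2) \<le> norm ((\<Sum>i=1..n. Y i w) - real n *\<^sub>R v)" by simp
  qed
  show "\<exists>E F. rare q E \<and> rare q F \<and>
      (\<forall>n. {w \<in> space M. norm ((\<Sum>i=1..n. Y i w + Z i w) - real n *\<^sub>R (v + u)) \<ge> real n * e} \<subseteq> E n \<union> F n)"
    by (intro exI[of _ ?E] exI[of _ ?F] conjI allI rapid_llnD[OF Y e] rapid_llnD[OF Z e] sub)
qed

text \<open>
  At \<open>n = 0\<close> the deviation event \<open>0 \<ge> 0 * e\<close> is the whole space, even for the zero sequence.
\<close>

lemma rare_only_at_0: "rare q (\<lambda>n. if n = 0 then space M else {})"
proof -
  have "(\<lambda>n. real n powr (q - 1) * prob (if n = 0 then space M else {})) \<longlonglongrightarrow> 0"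
    by (intro tendsto_eventually eventually_mono[OF eventually_gt_at_top[of 0]]) simp
  thus ?thesis unfolding rare_def by auto
qed

lemma rapid_lln_zero: "rapid_lln q (\<lambda>_ _. 0) 0"
proof (rule rapid_llnI)
  fix e :: real assume e: "e > 0"
  show "\<exists>E F. rare q E \<and> rare q F \<and>
      (\<forall>n. {w \<in> space M. norm ((\<Sum>i=1..n. 0) - real n *\<^sub>R 0 :: 'b) \<ge> real n * e} \<subseteq> E n \<union> F n)"
    using e by (intro exI[of _ "\<lambda>n. if n = 0 then space M else {}"] conjI rare_only_at_0)
      (auto simp: mult_le_0_iff)
qed auto

lemma rapid_lln_sum:
  assumes "finite I" "\<And>k. k \<in> I \<Longrightarrow> rapid_lln q (Y k) (v k)"
  shows "rapid_lln q (\<lambda>i w. \<Sum>k\<in>I. Y k i w) (\<Sum>k\<in>I. v k)"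
  using assms
proof (induction I rule: finite_induct)
  case empty
  show ?case using rapid_lln_zero by simp
next
  case (insert k I)
  hence "rapid_lln q (\<lambda>i w. Y k i w + (\<Sum>k\<in>I. Y k i w)) (v k + (\<Sum>k\<in>I. v k))"
    by (intro rapid_lln_add) auto
  thus ?case using insert by simp
qed

lemma rapid_lln_scaleR:
  fixes Y :: "nat \<Rightarrow> 'a \<Rightarrow> real" and v :: "'b::{real_normed_vector, second_countable_topology}"
  assumes Y: "rapid_lln q Y c"
  shows "rapid_lln q (\<lambda>i w. Y i w *\<^sub>R v) (c *\<^sub>R v)"
proof (rule rapid_llnI)
  show "random_variable borel (\<lambda>w. Y i w *\<^sub>R v)" if "i \<ge> 1" for i
    using rapid_lln_rv[OF Y that] by measurable
  fix e :: real assume "e > 0"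
  \<comment> \<open>The summand \<open>1\<close> covers the case \<open>v = 0\<close>.\<close>
  define d where "d = e / (1 + norm v)"
  have pos: "1 + norm v > 0" using norm_ge_zero[of v] by linarith
  have d: "d > 0" and e: "e = d * (1 + norm v)" using \<open>e > 0\<close> pos unfolding d_def by auto
  let ?E = "\<lambda>n. {w \<in> space M. norm ((\<Sum>i=1..n. Y i w) - real n *\<^sub>R c) \<ge> real n * d}"
  have sub: "{w \<in> space M. norm ((\<Sum>i=1..n. Y i w *\<^sub>R v) - real n *\<^sub>R (c *\<^sub>R v)) \<ge> real n * e} \<subseteq> ?E n \<union> ?E n" for n
  proof safe
    fix w assume w: "w \<in> space M" "real n * e \<le> norm ((\<Sum>i=1..n. Y i w *\<^sub>R v) - real n *\<^sub>R (c *\<^sub>R v))"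
    define S where "S = norm ((\<Sum>i=1..n. Y i w) - real n *\<^sub>R c)"
    have "(\<Sum>i=1..n. Y i w *\<^sub>R v) - real n *\<^sub>R (c *\<^sub>R v) = ((\<Sum>i=1..n. Y i w) - real n *\<^sub>R c) *\<^sub>R v"
      by (simp add: scaleR_sum_left scaleR_diff_left)
    hence "real n * e \<le> S * norm v" using w unfolding S_def by simp
    also have "\<dots> \<le> S * (1 + norm v)" by (intro mult_left_mono) (auto simp: S_def)
    finally have "real n * d * (1 + norm v) \<le> S * (1 + norm v)" unfolding e by (simp add: mult.assoc)
    thus "real n * d \<le> norm ((\<Sum>i=1..n. Y i w) - real n *\<^sub>R c)"
      using pos unfolding S_def by simp
  qed
  show "\<exists>E F. rare q E \<and> rare q F \<and>
      (\<forall>n. {w \<in> space M. norm ((\<Sum>i=1..n. Y i w *\<^sub>R v) - real n *\<^sub>R (c *\<^sub>R v)) \<ge> real n * e} \<subseteq> E n \<union> F n)"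
    by (intro exI[of _ ?E] conjI allI rapid_llnD[OF Y d] sub)
qed

text \<open>
  The lower tail for the number of visits to \<open>B\<close> is the upper tail for the visits to \<open>- B\<close>.
\<close>

lemma rapid_lln_indicator:
  fixes Y :: "nat \<Rightarrow> 'a \<Rightarrow> 'b::topological_space"
  assumes Y: "iid Y" and B: "B \<in> sets borel" and q: "q > 1"
  shows "rapid_lln q (\<lambda>i w. indicator B (Y i w) :: real) (expectation (\<lambda>w. indicator B (Y 1 w)))"
proof (rule rapid_llnI)
  have rv: "random_variable borel (\<lambda>w. indicator C (Y i w) :: real)" if "i \<ge> 1" "C \<in> sets borel" for i C
    using iid_rv[OF Y that(1)] that(2) by measurable
  show "random_variable borel (\<lambda>w. indicator B (Y i w) :: real)" if "i \<ge> 1" for i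
    by (rule rv[OF that B])
  fix e :: real assume e: "e > 0"
  define p :: real where "p = expectation (\<lambda>w. indicator B (Y 1 w))"
  have int: "integrable M (\<lambda>w. indicator C (Y 1 w) :: real)" if "C \<in> sets borel" for C
    by (rule integrable_const_bound[of _ 1]) (use rv[of 1 C] that in \<open>auto simp: indicator_def\<close>)
  have R: "rare q (\<lambda>n. {w \<in> space M. real n * (expectation (\<lambda>w. indicator C (Y 1 w)) + e)
      \<le> (\<Sum>i=1..n. indicator C (Y i w))})" if C: "C \<in> sets borel" for C
  proof (rule iid_upper_tail_rare[OF iid_compose[OF Y] _ _ q e])
    show "integrable M (\<lambda>w. indicator C (Y 1 w) powr q :: real)"
      by (rule Bochner_Integration.integrable_cong[THEN iffD1, OF refl _ int[OF C]]) (auto simp: indicator_def)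
  qed (use C in auto)
  have compl: "indicator (- B) y = (1 - indicator B y :: real)" for y by (auto simp: indicator_def)
  have p': "expectation (\<lambda>w. indicator (- B) (Y 1 w)) = 1 - p"
    unfolding compl p_def using int[OF B] by (subst Bochner_Integration.integral_diff) (auto simp: prob_space)
  have sub: "{w \<in> space M. real n * e \<le> norm ((\<Sum>i = 1..n. indicator B (Y i w)) - real n *\<^sub>R p)}
    \<subseteq> {w \<in> space M. real n * (p + e) \<le> (\<Sum>i=1..n. indicator B (Y i w))} \<union>
      {w \<in> space M. real n * (1 - p + e) \<le> (\<Sum>i=1..n. indicator (- B) (Y i w))}" for n
    unfolding compl by (auto simp: sum_subtractf algebra_simps abs_if split: if_splits)
  show "\<exists>E F. rare q E \<and> rare q F \<and>
      (\<forall>n. {w \<in> space M. norm ((\<Sum>i=1..n. indicator B (Y i w)) - real n *\<^sub>R expectation (\<lambda>w. indicator B (Y 1 w)) :: real)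
        \<ge> real n * e} \<subseteq> E n \<union> F n)"
    using R[OF B] R[of "- B"] B sub unfolding p' p_def[symmetric]
    by (intro exI[of _ "\<lambda>n. {w \<in> space M. real n * (p + e) \<le> (\<Sum>i=1..n. indicator B (Y i w))}"]
      exI[of _ "\<lambda>n. {w \<in> space M. real n * (1 - p + e) \<le> (\<Sum>i=1..n. indicator (- B) (Y i w))}"] conjI allI) auto
qed

lemma rapid_lln_simple_function:
  fixes Y :: "nat \<Rightarrow> 'a \<Rightarrow> 'b::topological_space" and s :: "'b \<Rightarrow> 'c::{banach, second_countable_topology}"
  assumes Y: "iid Y" and s: "simple_function borel s" and q: "q > 1"
  shows "rapid_lln q (\<lambda>i w. s (Y i w)) (expectation (\<lambda>w. s (Y 1 w)))"
proof -
  let ?B = "\<lambda>y. s -` {y}"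
  have fin: "finite (range s)" and B: "\<And>y. ?B y \<in> sets borel"
    using s simple_functionD[OF s] by auto
  have s_eq: "s x = (\<Sum>y\<in>range s. indicator (?B y) x *\<^sub>R y)" for x
  proof -
    have "(\<Sum>y\<in>range s. indicator (?B y) x *\<^sub>R y) = (\<Sum>y\<in>range s. if y = s x then y else 0)"
      by (intro sum.cong) (auto simp: indicator_def)
    thus ?thesis using fin by simp
  qed
  have Y1: "random_variable borel (Y 1)" by (rule iid_rv[OF Y]) simp
  have int: "integrable M (\<lambda>w. indicator (?B y) (Y 1 w) :: real)" for y
  proof (rule integrable_const_bound[of _ 1])
    show "random_variable borel (\<lambda>w. indicator (?B y) (Y 1 w) :: real)"
      using measurable_compose[OF Y1 borel_measurable_indicator[OF B]] .
  qed (simp add: indicator_def)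
  have "expectation (\<lambda>w. s (Y 1 w)) = (\<Sum>y\<in>range s. expectation (\<lambda>w. indicator (?B y) (Y 1 w)) *\<^sub>R y)"
  proof -
    have "expectation (\<lambda>w. s (Y 1 w)) = expectation (\<lambda>w. \<Sum>y\<in>range s. indicator (?B y) (Y 1 w) *\<^sub>R y)"
      by (subst s_eq) (rule refl)
    also have "\<dots> = (\<Sum>y\<in>range s. expectation (\<lambda>w. indicator (?B y) (Y 1 w) *\<^sub>R y))"
      by (rule Bochner_Integration.integral_sum) (rule integrable_scaleR_left, rule int)
    also have "\<dots> = (\<Sum>y\<in>range s. expectation (\<lambda>w. indicator (?B y) (Y 1 w)) *\<^sub>R y)"
      by (intro sum.cong refl integral_scaleR_left int)
    finally show ?thesis .
  qed
  hence mean: "(\<Sum>y\<in>range s. expectation (\<lambda>w. indicator (?B y) (Y 1 w)) *\<^sub>R y) = expectation (\<lambda>w. s (Y 1 w))"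
    by (rule sym)
  have sum: "(\<lambda>i w. \<Sum>y\<in>range s. indicator (?B y) (Y i w) *\<^sub>R y) = (\<lambda>i w. s (Y i w))"
    by (intro ext s_eq[symmetric])
  have "rapid_lln q (\<lambda>i w. \<Sum>y\<in>range s. indicator (?B y) (Y i w) *\<^sub>R y)
      (\<Sum>y\<in>range s. expectation (\<lambda>w. indicator (?B y) (Y 1 w)) *\<^sub>R y)"
    by (rule rapid_lln_sum[OF fin]) (rule rapid_lln_scaleR[OF rapid_lln_indicator[OF Y B q]])
  thus ?thesis by (subst (asm) mean, subst (asm) sum)
qed

text \<open>
  By separability there are simple functions \<open>s k\<close> on the space that converge to the identity with \<open>norm (s k x) \<le> 2 * norm x\<close>. One index \<open>k\<close> with mean error below \<open>e / 4\<close> is fixed; the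
  deviation of \<open>Y\<close> is then split into the deviation of \<open>s k Y\<close>, the sum of the errors, and
  \<open>n\<close> times the difference of the means.
\<close>

theorem iid_rapid_lln:
  fixes Y :: "nat \<Rightarrow> 'a \<Rightarrow> 'b::{banach, second_countable_topology}"
  assumes Y: "iid Y" and int: "integrable M (\<lambda>w. norm (Y 1 w) powr q)" and q: "q > 1"
  shows "rapid_lln q Y (expectation (Y 1))"
proof (rule rapid_llnI)
  show rv: "random_variable borel (Y i)" if "i \<ge> 1" for i by (rule iid_rv[OF Y that])
  have Y1 [measurable]: "random_variable borel (Y 1)" by (rule rv) simp
  have int_Y: "integrable M (Y 1)" by (rule integrable_if_norm_powr[OF Y1 int]) (use q in simp)
  hence int1: "integrable M (\<lambda>w. norm (Y 1 w))" by simp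
  fix e :: real assume "e > 0"
  hence e: "e / 4 > 0" by simp
  obtain s :: "nat \<Rightarrow> 'b \<Rightarrow> 'b" where s: "\<And>k. simple_function borel (s k)"
    and s_lim: "\<And>x. (\<lambda>k. s k x) \<longlonglongrightarrow> x" and s_bound: "\<And>k x. norm (s k x) \<le> 2 * norm x"
    using borel_measurable_implies_sequence_metric[of "\<lambda>x::'b. x" borel 0] by auto
  have [measurable]: "s k \<in> borel_measurable borel" for k
    using s by (rule borel_measurable_simple_function)
  have s_diff: "norm (s k x - x) \<le> 3 * norm x" for k x
    using norm_triangle_ineq4[of "s k x" x] s_bound[of k x] by linarith
  have "(\<lambda>k. expectation (\<lambda>w. norm (s k (Y 1 w) - Y 1 w))) \<longlonglongrightarrow> expectation (\<lambda>_. 0)"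
  proof (rule integral_dominated_convergence)
    show "AE w in M. (\<lambda>k. norm (s k (Y 1 w) - Y 1 w)) \<longlonglongrightarrow> 0"
      using s_lim by (auto intro!: AE_I2 tendsto_norm_zero simp: LIM_zero_iff)
    show "integrable M (\<lambda>w. 3 * norm (Y 1 w))" using int1 by simp
    show "random_variable borel (\<lambda>w. norm (s k (Y 1 w) - Y 1 w))" for k by measurable
    show "AE w in M. norm (norm (s k (Y 1 w) - Y 1 w)) \<le> 3 * norm (Y 1 w)" for k
      using s_diff by simp
  qed measurable
  hence "(\<lambda>k. expectation (\<lambda>w. norm (s k (Y 1 w) - Y 1 w))) \<longlonglongrightarrow> 0" by simp
  from order_tendstoD(2)[OF this e]
  obtain k where k: "expectation (\<lambda>w. norm (s k (Y 1 w) - Y 1 w)) < e / 4"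
    by (auto simp: eventually_sequentially)
  define W where "W i w = norm (s k (Y i w) - Y i w)" for i w
  define d where "d = expectation (W 1)"
  have d: "d < e / 4" using k unfolding d_def W_def by simp
  have W: "iid W" unfolding W_def by (rule iid_compose[OF Y]) measurable
  have W_int: "integrable M (\<lambda>w. W 1 w powr q)"
  proof (rule Bochner_Integration.integrable_bound)
    show "integrable M (\<lambda>w. 3 powr q * norm (Y 1 w) powr q)" using int by simp
    show "random_variable borel (\<lambda>w. W 1 w powr q)" unfolding W_def by measurable
    have "W 1 w powr q \<le> (3 * norm (Y 1 w)) powr q" for w
      unfolding W_def using s_diff q by (intro powr_mono2) auto
    thus "AE w in M. norm (W 1 w powr q) \<le> norm (3 powr q * norm (Y 1 w) powr q)"
      by (simp add: powr_mult)
  qed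
  let ?\<mu> = "expectation (Y 1)" and ?v = "expectation (\<lambda>w. s k (Y 1 w))"
  have sint: "integrable M (\<lambda>w. s k (Y 1 w))"
  proof (rule Bochner_Integration.integrable_bound)
    show "integrable M (\<lambda>w. 2 * norm (Y 1 w))" using int1 by simp
    show "AE w in M. norm (s k (Y 1 w)) \<le> norm (2 * norm (Y 1 w))" using s_bound by simp
  qed measurable
  have "norm (?v - ?\<mu>) = norm (expectation (\<lambda>w. s k (Y 1 w) - Y 1 w))"
    using sint int_Y by simp
  also have "\<dots> \<le> d" unfolding d_def W_def by (rule integral_norm_bound)
  finally have v: "norm (?v - ?\<mu>) \<le> d" .
  let ?E = "\<lambda>n. {w \<in> space M. norm ((\<Sum>i=1..n. s k (Y i w)) - real n *\<^sub>R ?v) \<ge> real n * (e / 4)}"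
  let ?F = "\<lambda>n. {w \<in> space M. (\<Sum>i=1..n. W i w) \<ge> real n * (d + e / 4)}"
  have E: "rare q ?E" by (rule rapid_llnD[OF rapid_lln_simple_function[OF Y s q] e])
  have F: "rare q ?F" unfolding d_def
    by (rule iid_upper_tail_rare[OF W _ W_int q e]) (simp add: W_def)
  have sub: "{w \<in> space M. norm ((\<Sum>i=1..n. Y i w) - real n *\<^sub>R ?\<mu>) \<ge> real n * e} \<subseteq> ?E n \<union> ?F n" for n
  proof safe
    fix w assume w: "w \<in> space M" "real n * e \<le> norm ((\<Sum>i=1..n. Y i w) - real n *\<^sub>R ?\<mu>)"
      and nF: "\<not> real n * (d + e / 4) \<le> (\<Sum>i=1..n. W i w)"
    define D where "D = (\<Sum>i=1..n. s k (Y i w)) - real n *\<^sub>R ?v"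
    define R where "R = (\<Sum>i=1..n. s k (Y i w) - Y i w)"
    have "(\<Sum>i=1..n. Y i w) - real n *\<^sub>R ?\<mu> = (D - R) + real n *\<^sub>R (?v - ?\<mu>)"
      unfolding D_def R_def by (simp add: sum_subtractf scaleR_diff_right)
    hence "real n * e \<le> norm (D - R) + norm (real n *\<^sub>R (?v - ?\<mu>))"
      using w norm_triangle_ineq[of "D - R" "real n *\<^sub>R (?v - ?\<mu>)"] by simp
    also have "norm (D - R) \<le> norm D + norm R" by (rule norm_triangle_ineq4)
    also have "norm R \<le> (\<Sum>i=1..n. W i w)" unfolding R_def W_def by (rule norm_sum)
    also have "\<dots> \<le> real n * (d + e / 4)" using nF by simp
    also have "norm (real n *\<^sub>R (?v - ?\<mu>)) \<le> real n * d" using v by (simp add: mult_left_mono)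
    finally have "real n * e \<le> norm D + real n * (d + e / 4) + real n * d" by simp
    hence "real n * e - real n * (2 * d + e / 4) \<le> norm D" by (simp add: algebra_simps)
    moreover have "real n * (2 * d + e / 4) \<le> real n * (3 * e / 4)" using d by (intro mult_left_mono) auto
    ultimately show "real n * (e / 4) \<le> norm ((\<Sum>i=1..n. s k (Y i w)) - real n *\<^sub>R ?v)"
      unfolding D_def[symmetric] by simp
  qed
  show "\<exists>E F. rare q E \<and> rare q F \<and>
      (\<forall>n. {w \<in> space M. norm ((\<Sum>i=1..n. Y i w) - real n *\<^sub>R ?\<mu>) \<ge> real n * e} \<subseteq> E n \<union> F n)"
    by (intro exI[of _ ?E] exI[of _ ?F] conjI allI E F sub)
qed


section \<open>The rate function at the mean\<close>

text \<open>
  Integrating the tangent inequality at \<open>u = 1 + f (Y w) - m\<close> gives \<open>1 + q * (f \<mu> - m) \<le> 1\<close> for every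
  admissible \<open>m\<close>.
\<close>

lemma Lambda_ge_mean:
  fixes Y :: "'a \<Rightarrow> 'b::{banach, second_countable_topology}"
  assumes Y: "integrable M Y" and q: "q > 1"
  shows "ereal (blinfun_apply f (expectation Y)) \<le> Lambda M Y q f"
  unfolding Lambda_def
proof (rule Inf_greatest, safe)
  fix m :: real
  let ?g = "\<lambda>w. max (1 + blinfun_apply f (Y w) - m) 0 powr q"
  assume le: "(\<integral>\<^sup>+ w. ennreal (?g w) \<partial>M) \<le> 1"
  have [measurable]: "random_variable borel Y" using Y by auto
  have fY: "integrable M (\<lambda>w. blinfun_apply f (Y w))"
    by (rule integrable_bounded_linear[OF blinfun.bounded_linear_right Y])
  have g: "integrable M ?g"
    using le fY by (intro integrableI_nonneg) (auto simp: le_less_trans)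
  have "ennreal (expectation ?g) \<le> 1"
    using le nn_integral_eq_integral[OF g] by simp
  hence "expectation ?g \<le> 1" by simp
  moreover have "expectation (\<lambda>w. 1 + q * (blinfun_apply f (Y w) - m)) \<le> expectation ?g"
    using fY g powr_ge_tangent_at_1[OF q, of "1 + blinfun_apply f (Y _) - m"]
    by (intro integral_mono) auto
  moreover have "expectation (\<lambda>w. 1 + q * (blinfun_apply f (Y w) - m)) = 1 + q * (blinfun_apply f (expectation Y) - m)"
    using fY Y by (simp add: prob_space integral_bounded_linear[OF blinfun.bounded_linear_right])
  ultimately have "q * (blinfun_apply f (expectation Y) - m) \<le> 0" by linarith
  hence "blinfun_apply f (expectation Y) \<le> m" using q by (simp add: mult_le_0_iff)
  thus "ereal (blinfun_apply f (expectation Y)) \<le> ereal m" by simp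
qed

lemma conj_fun_mean_le_0:
  fixes Y :: "'a \<Rightarrow> 'b::{banach, second_countable_topology}"
  assumes "integrable M Y" "q > 1"
  shows "conj_fun (Lambda M Y q) (expectation Y) \<le> 0"
  unfolding conj_fun_def
proof (rule SUP_least)
  fix f
  show "ereal (blinfun_apply f (expectation Y)) - Lambda M Y q f \<le> 0"
    using Lambda_ge_mean[OF assms, of f] by (cases "Lambda M Y q f") auto
qed

text \<open>The functional \<open>0\<close> contributes \<open>- \<Lambda> 0\<close>, and \<open>m = 0\<close> is admissible for it.\<close>

lemma conj_fun_nonneg: "conj_fun (Lambda M Y q) x \<ge> 0"
proof -
  have "Lambda M Y q 0 \<le> ereal 0"
    unfolding Lambda_def by (rule Inf_lower) (auto simp: emeasure_space_1)
  hence "0 \<le> ereal (blinfun_apply 0 x) - Lambda M Y q 0"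
    by (cases "Lambda M Y q 0") auto
  also have "\<dots> \<le> conj_fun (Lambda M Y q) x" unfolding conj_fun_def by (rule SUP_upper) simp
  finally show ?thesis .
qed

end

section \<open>The upper bound for closed sets\<close>

lemma neg_power_nonneg: "neg_power a q \<ge> 0"
  unfolding neg_power_def by auto

theorem corollary1p4:
  fixes M :: "'w measure"
    and X :: "nat \<Rightarrow> 'w \<Rightarrow> 'a::{banach, second_countable_topology}"
    and q :: real
    and A :: "'a set"
  assumes "q > 1"
    and "prob_space M"
    and "prob_space.indep_vars M (\<lambda>_. borel) X {1..}"
    and "\<And>i. i \<ge> 1 \<Longrightarrow> distr M borel (X i) = distr M borel (X 1)"
    and "integrable M (\<lambda>w. norm (X 1 w) powr q)"
    and "closed A"
  shows "limsup (\<lambda>n. ereal (real n powr (q - 1) *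
             measure M {w \<in> space M. (1 / real n) *\<^sub>R (\<Sum>i=1..n. X i w) \<in> A}))
         \<le> neg_power (INF x\<in>A. conj_fun (Lambda M (X 1) q) x) q"
proof -
  interpret prob_space M by fact
  have X: "iid X" using assms(3,4) unfolding iid_def by blast
  have rv: "\<And>i. i \<ge> 1 \<Longrightarrow> random_variable borel (X i)" by (rule iid_rv[OF X])
  have X1: "random_variable borel (X 1)" by (rule rv) simp
  have int: "integrable M (X 1)"
    by (rule integrable_if_norm_powr[OF X1 assms(5)]) (use assms(1) in simp)
  define \<mu> where "\<mu> = expectation (X 1)"
  show ?thesis
  proof (cases "\<mu> \<in> A")
    case True
    have "(INF x\<in>A. conj_fun (Lambda M (X 1) q) x) = 0"
    proof (rule antisym)
      show "(INF x\<in>A. conj_fun (Lambda M (X 1) q) x) \<le> 0"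
        using conj_fun_mean_le_0[OF int assms(1)] True unfolding \<mu>_def by (rule INF_lower2[rotated])
    qed (intro INF_greatest conj_fun_nonneg)
    thus ?thesis by (simp add: neg_power_def)
  next
    case False
    with assms(6) obtain e where e: "e > 0" "\<And>y. y \<in> A \<Longrightarrow> e \<le> dist y \<mu>"
      unfolding closed_def open_dist by (metis ComplI not_le ComplD)
    have [measurable]: "A \<in> sets borel" using assms(6) by (rule borel_closed)
    let ?A = "\<lambda>n. {w \<in> space M. (1 / real n) *\<^sub>R (\<Sum>i=1..n. X i w) \<in> A}"
    let ?D = "\<lambda>n. {w \<in> space M. norm ((\<Sum>i=1..n. X i w) - real n *\<^sub>R \<mu>) \<ge> real n * e}"
    have D: "rare q ?D"
      unfolding \<mu>_def by (rule rapid_llnD[OF iid_rapid_lln[OF X assms(5,1)] e(1)])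
    have "rare q ?A"
    proof (rule rare_if_subset_Un[OF D D])
      fix n
      have [measurable]: "random_variable borel (\<lambda>w. \<Sum>i=1..n. X i w)"
        using rv by (intro borel_measurable_sum) auto
      show "?A n \<in> events" by measurable
      show "?A n \<subseteq> ?D n \<union> ?D n"
      proof (cases "n = 0")
        case False
        have "norm ((\<Sum>i=1..n. X i w) - real n *\<^sub>R \<mu>) = real n * dist ((1 / real n) *\<^sub>R (\<Sum>i=1..n. X i w)) \<mu>" for w
        proof -
          have "(\<Sum>i=1..n. X i w) - real n *\<^sub>R \<mu> = real n *\<^sub>R ((1 / real n) *\<^sub>R (\<Sum>i=1..n. X i w) - \<mu>)"
            using False by (simp add: scaleR_diff_right)
          thus ?thesis by (simp add: dist_norm)
        qed
        thus ?thesis using e(2) by (auto intro!: mult_left_mono)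
      qed auto
    qed
    hence "(\<lambda>n. ereal (real n powr (q - 1) * prob (?A n))) \<longlonglongrightarrow> ereal 0"
      unfolding rare_def by (intro tendsto_ereal) auto
    hence "limsup (\<lambda>n. ereal (real n powr (q - 1) * prob (?A n))) = 0"
      by (intro lim_imp_Limsup) (auto simp: zero_ereal_def)
    thus ?thesis using neg_power_nonneg by simp
  qed
qed

end
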